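(* Let $n\ge2$, $m\ge0$, $j\in\{2,\dots,n\}$, and for integers $k\ge0$ let $Q^{k,m}=\int_{x_1}^{x_j}t^k\prod_{i=1}^n(t-x_i)^m\,dt$. Let $$L_m=\sum_{i=1}^n\frac{\partial^2}{\partial x_i^2}-2m\sum_{1\le i<l\le n}\frac{1}{x_i-x_l}\left(\frac{\partial}{\partial x_i}-\frac{\partial}{\partial x_l}\right).$$ Then $L_m(Q^{k,m})=k(k-1)Q^{k-2,m}$ for $k\ge2$, and $L_m(Q^{k,m})=0$ for $k=0,1$.
   Context: $Q^{k,m}$ is the polynomial $Q_T^{k,m}$ associated with the standard tableau $T$ of shape $[n-1,1]$ whose second-row entry is $j$. *)

theory Defs
  imports "HOL-Complex_Analysis.Complex_Analysis"
begin

text \<open>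
  A polynomial or rational function in the variables \<open>x\<^sub>1, \<dots>, x\<^sub>n\<close> is represented by the function
  that it defines on points \<open>x :: nat \<Rightarrow> complex\<close>, of which only the coordinates \<open>x 1, \<dots>, x n\<close> matter.
\<close>

text \<open>
  The integrand is a polynomial in \<open>t\<close>, so the integral from \<open>x 1\<close> to \<open>x j\<close> does not depend on the
  path; it is taken along the segment, which for real endpoints (in either order) gives the
  usual oriented integral.
\<close>

definition Qint :: "nat \<Rightarrow> nat \<Rightarrow> nat \<Rightarrow> nat \<Rightarrow> (nat \<Rightarrow> complex) \<Rightarrow> complex" where
  "Qint n j k m x =
     contour_integral (linepath (x 1) (x j)) (\<lambda>t. t ^ k * (\<Prod>i=1..n. (t - x i) ^ m))"

definition partial_deriv ::
  "nat \<Rightarrow> ((nat \<Rightarrow> complex) \<Rightarrow> complex) \<Rightarrow> (nat \<Rightarrow> complex) \<Rightarrow> complex" where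
  "partial_deriv i f x = deriv (\<lambda>z. f (x(i := z))) (x i)"

text \<open>Meaningful only at points with pairwise distinct coordinates, where no denominator vanishes.\<close>

definition Lop ::
  "nat \<Rightarrow> nat \<Rightarrow> ((nat \<Rightarrow> complex) \<Rightarrow> complex) \<Rightarrow> (nat \<Rightarrow> complex) \<Rightarrow> complex" where
  "Lop n m f x =
     (\<Sum>i=1..n. partial_deriv i (partial_deriv i f) x)
     - 2 * of_nat m *
       (\<Sum>i=1..n. \<Sum>l\<in>{i<..n}.
          1 / (x i - x l) * (partial_deriv i f x - partial_deriv l f x))"

end

theory Submission
  imports Defs
begin

text \<open>
  Write \<open>P t = (\<Prod>i=1..n. (t - x i) ^ m)\<close>. Applied to the integrand, the operator gives
  \<open>t ^ k * P'' t\<close>, because \<open>1/(t - x i) - 1/(t - x l) = (x i - x l) / ((t - x i) (t - x l))\<close> cancels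
  the denominators of the first-order part. Integrating by parts twice moves both derivatives to
  \<open>t ^ k\<close>. For \<open>m = 1\<close>, the boundary terms \<open>t ^ k * P' t\<close> do not vanish; they cancel those that
  arise when the variable endpoints \<open>x 1\<close> and \<open>x j\<close> are differentiated.
\<close>

section \<open>Segment integrals depending on a parameter\<close>

lemma contour_integral_linepath_primitive:
  assumes "\<And>t. (F has_field_derivative f t) (at t)"
  shows "contour_integral (linepath a b) f = F b - F a"
  using contour_integral_primitive[of UNIV F f "linepath a b"] assms
  by (auto intro!: contour_integral_unique)

lemma contour_integrable_linepath_entire:
  assumes "f holomorphic_on UNIV"
  shows "f contour_integrable_on linepath a b"
  using assms by (intro contour_integrable_holomorphic_simple[of f UNIV]) auto

text \<open>Leibniz rule with the parameter \<open>z\<close> in both endpoints and the integrand.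
  Induction on \<open>m\<close>, for all entire \<open>g\<close> at once, avoids differentiating
  under the integral: \<open>(t - z) ^ Suc m * g t = (t - z) ^ m * (t * g t) - z * ((t - z) ^ m * g
  t)\<close> moves one factor \<open>z\<close> outside, until only a primitive of an entire function
  remains.\<close>

lemma has_field_derivative_linepath_integral:
  assumes g: "g holomorphic_on UNIV"
    and p: "(p has_field_derivative p') (at z)"
    and q: "(q has_field_derivative q') (at z)"
  shows "((\<lambda>z. contour_integral (linepath (p z) (q z)) (\<lambda>t. (t - z) ^ m * g t)) has_field_derivative
    (q' * ((q z - z) ^ m * g (q z)) - p' * ((p z - z) ^ m * g (p z))
      - of_nat m * contour_integral (linepath (p z) (q z)) (\<lambda>t. (t - z) ^ (m - 1) * g t))) (at z)"
  using g
proof (induction m arbitrary: g)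
  case 0
  obtain G where G: "\<And>t. (G has_field_derivative g t) (at t)"
    using holomorphic_convex_primitive'[OF convex_UNIV open_UNIV 0] by auto
  have "((\<lambda>z. G (q z) - G (p z)) has_field_derivative (g (q z) * q' - g (p z) * p')) (at z)"
    by (intro DERIV_diff DERIV_chain2[OF G] p q)
  then show ?case
    by (simp add: contour_integral_linepath_primitive[OF G] mult.commute)
next
  case (Suc m)
  let ?I = "\<lambda>z f. contour_integral (linepath (p z) (q z)) f"
  have split: "?I w (\<lambda>t. (t - z) ^ Suc d * h t)
      = ?I w (\<lambda>t. (t - z) ^ d * (t * h t)) - z * ?I w (\<lambda>t. (t - z) ^ d * h t)"
    if h: "h holomorphic_on UNIV" for w z d h
  proof -
    have "?I w (\<lambda>t. (t - z) ^ Suc d * h t)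
        = ?I w (\<lambda>t. (t - z) ^ d * (t * h t) - z * ((t - z) ^ d * h t))"
      by (simp add: algebra_simps)
    also have "\<dots> = ?I w (\<lambda>t. (t - z) ^ d * (t * h t)) - ?I w (\<lambda>t. z * ((t - z) ^ d * h t))"
      by (intro contour_integral_diff contour_integrable_linepath_entire holomorphic_intros h)
    also have "?I w (\<lambda>t. z * ((t - z) ^ d * h t)) = z * ?I w (\<lambda>t. (t - z) ^ d * h t)"
      by (intro contour_integral_lmul contour_integrable_linepath_entire holomorphic_intros h)
    finally show ?thesis .
  qed
  have tg: "(\<lambda>t. t * g t) holomorphic_on UNIV"
    by (intro holomorphic_intros Suc.prems)
  \<comment> \<open>Recombines the integral terms of the two induction hypotheses into
    \<open>m\<close> copies of the integral with exponent \<open>m\<close>; the product rule for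
    \<open>z * ?I z ...\<close> supplies one more copy, hence the coefficient \<open>Suc m\<close>.
    For \<open>m = 0\<close> the factor \<open>of_nat m\<close> makes both sides zero.\<close>
  have step: "of_nat m * ?I z (\<lambda>t. (t - z) ^ (m - 1) * (t * g t))
      - z * (of_nat m * ?I z (\<lambda>t. (t - z) ^ (m - 1) * g t))
      = of_nat m * ?I z (\<lambda>t. (t - z) ^ m * g t)"
  proof (cases m)
    case (Suc d)
    show ?thesis
      unfolding Suc diff_Suc_1 split[OF Suc.prems] by (simp only: algebra_simps)
  qed simp
  show ?case
    unfolding split[OF Suc.prems]
    by (rule DERIV_cong[OF DERIV_diff[OF Suc.IH[OF tg] DERIV_mult[OF DERIV_ident Suc.IH[OF Suc.prems]]]])
      (use step in \<open>simp add: algebra_simps\<close>)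
qed

section \<open>The product, its first two derivatives in \<open>t\<close>, and sums over pairs of
  indices\<close>

text \<open>The index set is a parameter so that the factors of one or two indices can be split off;
  the cofactor over \<open>A - {i}\<close> no longer depends on \<open>x i\<close>.\<close>

definition pow_prod :: "nat set \<Rightarrow> nat \<Rightarrow> (nat \<Rightarrow> complex) \<Rightarrow> complex \<Rightarrow> complex" where
  "pow_prod A m x t = (\<Prod>i\<in>A. (t - x i) ^ m)"

lemma holomorphic_on_pow_prod [holomorphic_intros]:
  "f holomorphic_on S \<Longrightarrow> (\<lambda>t. pow_prod A m x (f t)) holomorphic_on S"
  unfolding pow_prod_def by (intro holomorphic_intros)

lemma pow_prod_remove:
  assumes "finite A" "i \<in> A"
  shows "pow_prod A m x t = (t - x i) ^ m * pow_prod (A - {i}) m x t"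
  unfolding pow_prod_def using assms by (rule prod.remove)

lemma pow_prod_root:
  assumes "finite A" "i \<in> A" "m > 0"
  shows "pow_prod A m x (x i) = 0"
  using pow_prod_remove[OF assms(1,2)] assms(3) by simp

lemma pow_prod_upd: "i \<notin> A \<Longrightarrow> pow_prod A m (x(i := z)) t = pow_prod A m x t"
  unfolding pow_prod_def by (intro prod.cong) auto

text \<open>The derivative of \<open>pow_prod\<close> in \<open>t\<close>, written without quotients
  by \<open>t - x i\<close> so that it can be evaluated at the roots, where the boundary terms
  live.\<close>

definition pow_prod' :: "nat set \<Rightarrow> nat \<Rightarrow> (nat \<Rightarrow> complex) \<Rightarrow> complex \<Rightarrow> complex" where
  "pow_prod' A m x t = of_nat m * (\<Sum>i\<in>A. (t - x i) ^ (m - 1) * pow_prod (A - {i}) m x t)"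

lemma DERIV_pow_prod:
  "(pow_prod A m x has_field_derivative pow_prod' A m x t) (at t)"
proof -
  have "((\<lambda>t. \<Prod>i\<in>A. (t - x i) ^ m) has_field_derivative
      (\<Sum>i\<in>A. of_nat m * (t - x i) ^ (m - 1) * (\<Prod>l\<in>A - {i}. (t - x l) ^ m))) (at t)"
    by (rule has_field_derivative_prod) (auto intro!: derivative_eq_intros)
  then show ?thesis
    unfolding pow_prod'_def pow_prod_def[abs_def] by (simp add: sum_distrib_left mult.assoc)
qed

text \<open>Every summand with index other than \<open>i\<close> still contains the factor
  \<open>(t - x i) ^ m\<close>, which vanishes at \<open>x i\<close>. The remaining
  \<open>0 ^ (m - 1)\<close> is 1 for \<open>m = 1\<close> and 0 for larger \<open>m\<close>, so
  boundary terms occur only for \<open>m = 1\<close>.\<close>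

lemma pow_prod'_root:
  assumes "finite A" "i \<in> A" "m > 0"
  shows "pow_prod' A m x (x i) = of_nat m * (0 ^ (m - 1) * pow_prod (A - {i}) m x (x i))"
proof -
  have "(\<Sum>l\<in>A - {i}. (x i - x l) ^ (m - 1) * pow_prod (A - {l}) m x (x i)) = 0"
    using assms by (intro sum.neutral) (auto intro!: pow_prod_root)
  then show ?thesis
    unfolding pow_prod'_def using assms by (simp add: sum.remove[of A i])
qed

text \<open>The second derivative in \<open>t\<close>, sorted to match the operator: the single sum
  will come from the pure second derivatives, the double sum over ordered pairs from the first-order
  part. The truncated \<open>m - 2\<close> is harmless, as its coefficient vanishes for
  \<open>m < 2\<close>.\<close>

definition pow_prod'' :: "nat set \<Rightarrow> nat \<Rightarrow> (nat \<Rightarrow> complex) \<Rightarrow> complex \<Rightarrow> complex" where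
  "pow_prod'' A m x t =
    of_nat m * of_nat (m - 1) * (\<Sum>i\<in>A. (t - x i) ^ (m - 2) * pow_prod (A - {i}) m x t)
    + of_nat m ^ 2 * (\<Sum>i\<in>A. \<Sum>l\<in>A - {i}.
        (t - x i) ^ (m - 1) * (t - x l) ^ (m - 1) * pow_prod (A - {i} - {l}) m x t)"

lemma DERIV_pow_prod':
  "(pow_prod' A m x has_field_derivative pow_prod'' A m x t) (at t)"
proof -
  have "((\<lambda>t. of_nat m * (\<Sum>i\<in>A. (t - x i) ^ (m - 1) * pow_prod (A - {i}) m x t))
    has_field_derivative
    of_nat m * (\<Sum>i\<in>A. of_nat (m - 1) * (t - x i) ^ (m - 2) * pow_prod (A - {i}) m x t
      + pow_prod' (A - {i}) m x t * (t - x i) ^ (m - 1))) (at t)"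
    by (intro DERIV_cmult DERIV_sum DERIV_mult DERIV_pow_prod)
      (auto intro!: derivative_eq_intros simp: diff_diff_add numeral_2_eq_2)
  moreover have "of_nat m * (\<Sum>i\<in>A. of_nat (m - 1) * (t - x i) ^ (m - 2) * pow_prod (A - {i}) m x t
      + pow_prod' (A - {i}) m x t * (t - x i) ^ (m - 1)) = pow_prod'' A m x t"
    unfolding pow_prod''_def pow_prod'_def
    by (simp add: sum.distrib sum_distrib_left algebra_simps power2_eq_square)
  ultimately show ?thesis
    unfolding pow_prod'_def[abs_def] by simp
qed

text \<open>Explains the 2 in \<open>Lop\<close>: the operator sums over \<open>i < l\<close>, the
  second derivative of the product over ordered pairs. The part below the diagonal is carried to the
  part above it by swapping indices.\<close>

lemma sum_offdiag_symmetric: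
  fixes f :: "nat \<Rightarrow> nat \<Rightarrow> 'a::comm_semiring_1"
  assumes "\<And>i l. f i l = f l i"
  shows "(\<Sum>i=1..n. \<Sum>l\<in>{1..n} - {i}. f i l) = 2 * (\<Sum>i=1..n. \<Sum>l\<in>{i<..n}. f i l)"
proof -
  have "(\<Sum>l\<in>{1..n} - {i}. f i l) = (\<Sum>l\<in>{1..<i}. f i l) + (\<Sum>l\<in>{i<..n}. f i l)"
    if "i \<in> {1..n}" for i
  proof -
    have split: "{1..n} - {i} = {1..<i} \<union> {i<..n}" using that by auto
    show ?thesis unfolding split by (rule sum.union_disjoint) auto
  qed
  moreover have "(\<Sum>i=1..n. \<Sum>l\<in>{1..<i}. f i l) = (\<Sum>i=1..n. \<Sum>l\<in>{i<..n}. f i l)"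
  proof -
    have "(\<Sum>i=1..n. \<Sum>l\<in>{1..<i}. f i l) = (\<Sum>(i,l)\<in>(SIGMA i:{1..n}. {1..<i}). f i l)"
      by (simp add: sum.Sigma)
    also have "\<dots> = (\<Sum>(i,l)\<in>(SIGMA i:{1..n}. {i<..n}). f i l)"
      by (rule sum.reindex_bij_witness[of _ "\<lambda>(i,l). (l,i)" "\<lambda>(i,l). (l,i)"])
        (auto simp: assms)
    finally show ?thesis by (simp add: sum.Sigma)
  qed
  ultimately show ?thesis
    by (simp add: sum.distrib mult_2)
qed

section \<open>Partial derivatives of the integral for \<open>m > 0\<close>\<close>

lemma Qint_pow_prod:
  "Qint n j k m x =
    contour_integral (linepath (x 1) (x j)) (\<lambda>t. t ^ k * pow_prod {1..n} m x t)"
  unfolding Qint_def pow_prod_def ..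

lemma Qint_remove:
  assumes "i \<in> {1..n}"
  shows "Qint n j k m x =
    contour_integral (linepath (x 1) (x j))
      (\<lambda>t. (t - x i) ^ m * (t ^ k * pow_prod ({1..n} - {i}) m x t))"
  unfolding Qint_pow_prod pow_prod_remove[OF finite_atLeastAtMost assms]
  by (simp only: mult.left_commute)

text \<open>An endpoint moves with unit speed if it is the coordinate being varied and stays fixed
  otherwise; \<open>of_bool\<close> records this without a case distinction on
  \<open>i\<close>.\<close>

lemma DERIV_coordinate_integral:
  assumes "g holomorphic_on UNIV"
  shows "((\<lambda>z. contour_integral (linepath ((x(i := z)) a) ((x(i := z)) b)) (\<lambda>t. (t - z) ^ m * g t))
    has_field_derivative
    (of_bool (i = b) * ((x b - x i) ^ m * g (x b)) - of_bool (i = a) * ((x a - x i) ^ m * g (x a))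
      - of_nat m * contour_integral (linepath (x a) (x b)) (\<lambda>t. (t - x i) ^ (m - 1) * g t))) (at (x i))"
proof -
  have coord: "((\<lambda>z. (x(i := z)) c) has_field_derivative of_bool (i = c)) (at (x i))" for c
    by (cases "i = c") auto
  from has_field_derivative_linepath_integral[OF assms coord[of a] coord[of b], of m]
  show ?thesis by simp
qed

text \<open>A moving endpoint contributes nothing here: its term carries
  \<open>(x i - x i) ^ m\<close>, which is zero for \<open>m > 0\<close>.\<close>

lemma partial_deriv_Qint:
  assumes i: "i \<in> {1..n}" and m: "m > 0"
  shows "partial_deriv i (Qint n j k m) x =
    - of_nat m * contour_integral (linepath (x 1) (x j))
      (\<lambda>t. (t - x i) ^ (m - 1) * (t ^ k * pow_prod ({1..n} - {i}) m x t))"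
proof -
  have eq: "Qint n j k m (x(i := z)) =
      contour_integral (linepath ((x(i := z)) 1) ((x(i := z)) j))
        (\<lambda>t. (t - z) ^ m * (t ^ k * pow_prod ({1..n} - {i}) m x t))" for z
    unfolding Qint_remove[OF i] by (simp add: pow_prod_upd)
  have hol: "(\<lambda>t. t ^ k * pow_prod ({1..n} - {i}) m x t) holomorphic_on UNIV"
    by (intro holomorphic_intros)
  show ?thesis
    unfolding partial_deriv_def eq using m
    by (intro DERIV_imp_deriv DERIV_cong[OF DERIV_coordinate_integral[OF hol]]) auto
qed

text \<open>After the first derivative the exponent is \<open>m - 1\<close>, so a moving endpoint
  now contributes a multiple of \<open>0 ^ (m - 1)\<close>, nonzero only if \<open>m = 1\<close>.
  \<open>pow_prod'_root\<close> rewrites it through \<open>pow_prod'\<close>, the form in which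
  integration by parts will produce it.\<close>

lemma partial_deriv2_Qint:
  assumes i: "i \<in> {1..n}" and m: "m > 0"
  shows "partial_deriv i (partial_deriv i (Qint n j k m)) x =
    of_nat m * of_nat (m - 1) * contour_integral (linepath (x 1) (x j))
      (\<lambda>t. (t - x i) ^ (m - 2) * (t ^ k * pow_prod ({1..n} - {i}) m x t))
    - of_bool (i = j) * (x i ^ k * pow_prod' {1..n} m x (x i))
    + of_bool (i = 1) * (x i ^ k * pow_prod' {1..n} m x (x i))"
proof -
  have eq: "partial_deriv i (Qint n j k m) (x(i := z)) =
      - of_nat m * contour_integral (linepath ((x(i := z)) 1) ((x(i := z)) j))
        (\<lambda>t. (t - z) ^ (m - 1) * (t ^ k * pow_prod ({1..n} - {i}) m x t))" for z
    unfolding partial_deriv_Qint[OF i m] by (simp add: pow_prod_upd)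
  have hol: "(\<lambda>t. t ^ k * pow_prod ({1..n} - {i}) m x t) holomorphic_on UNIV"
    by (intro holomorphic_intros)
  have "m - 1 - 1 = m - 2" by simp
  then show ?thesis
    unfolding partial_deriv_def[of i "partial_deriv i (Qint n j k m)"] eq
    using pow_prod'_root[of "{1..n}" i m x] i m
    by (intro DERIV_imp_deriv DERIV_cong[OF DERIV_cmult[OF DERIV_coordinate_integral[OF hol]]])
      (auto simp: algebra_simps of_bool_def)
qed

text \<open>With the factors of both \<open>i\<close> and \<open>l\<close> split off, the two
  integrands share everything except one factor, \<open>t - x l\<close> in the first and
  \<open>t - x i\<close> in the second. Their difference \<open>x i - x l\<close> cancels the
  denominator.\<close>

lemma partial_deriv_Qint_diff:
  assumes i: "i \<in> {1..n}" and l: "l \<in> {1..n}" and m: "m > 0" and ne: "x i \<noteq> x l"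
  shows "1 / (x i - x l) * (partial_deriv i (Qint n j k m) x - partial_deriv l (Qint n j k m) x) =
    - of_nat m * contour_integral (linepath (x 1) (x j))
      (\<lambda>t. t ^ k * ((t - x i) ^ (m - 1) * (t - x l) ^ (m - 1) * pow_prod ({1..n} - {i} - {l}) m x t))"
proof -
  let ?I = "contour_integral (linepath (x 1) (x j))"
  let ?f = "\<lambda>i t. (t - x i) ^ (m - 1) * (t ^ k * pow_prod ({1..n} - {i}) m x t)"
  let ?h = "\<lambda>t. t ^ k * ((t - x i) ^ (m - 1) * (t - x l) ^ (m - 1) * pow_prod ({1..n} - {i} - {l}) m x t)"
  have il: "i \<noteq> l" using ne by auto
  obtain d where d: "m = Suc d" using m gr0_implies_Suc by blast
  have comm: "{1..n} - {l} - {i} = {1..n} - {i} - {l}" by auto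
  have eq: "?f i t - ?f l t = (x i - x l) * ?h t" for t
  proof -
    have "pow_prod ({1..n} - {i}) m x t = (t - x l) ^ m * pow_prod ({1..n} - {i} - {l}) m x t"
      using l il by (intro pow_prod_remove) auto
    moreover have "pow_prod ({1..n} - {l}) m x t = (t - x i) ^ m * pow_prod ({1..n} - {i} - {l}) m x t"
      using i il unfolding comm[symmetric] by (intro pow_prod_remove) auto
    ultimately show ?thesis
      unfolding d by (simp only: diff_Suc_1 power_Suc) (simp add: algebra_simps)
  qed
  have "?I (?f i) - ?I (?f l) = ?I (\<lambda>t. ?f i t - ?f l t)"
    by (intro contour_integral_diff[symmetric] contour_integrable_linepath_entire holomorphic_intros)
  also have "\<dots> = (x i - x l) * ?I ?h"
    unfolding eq
    by (intro contour_integral_lmul contour_integrable_linepath_entire holomorphic_intros)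
  finally have "?I (?f i) - ?I (?f l) = (x i - x l) * ?I ?h" .
  then have "partial_deriv i (Qint n j k m) x - partial_deriv l (Qint n j k m) x
      = - of_nat m * ((x i - x l) * ?I ?h)"
    unfolding partial_deriv_Qint[OF i m] partial_deriv_Qint[OF l m]
    by (simp only: right_diff_distrib[symmetric])
  then show ?thesis using ne by simp
qed

section \<open>Integration by parts and assembly for \<open>m > 0\<close>\<close>

lemma contour_integral_pow_prod'':
  assumes "finite A" "a \<in> A" "b \<in> A" "m > 0"
  shows "contour_integral (linepath (x a) (x b)) (\<lambda>t. t ^ k * pow_prod'' A m x t) =
    x b ^ k * pow_prod' A m x (x b) - x a ^ k * pow_prod' A m x (x a)
    + of_nat k * of_nat (k - 1) *
      contour_integral (linepath (x a) (x b)) (\<lambda>t. t ^ (k - 2) * pow_prod A m x t)"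
proof -
  let ?I = "contour_integral (linepath (x a) (x b))"
  \<comment> \<open>Both integrations by parts in a single antiderivative: the mixed terms
    \<open>k * t ^ (k - 1) * pow_prod' A m x t\<close> cancel on differentiation. At the endpoints
    \<open>pow_prod\<close> vanishes because they are roots and \<open>m > 0\<close>, leaving only
    the \<open>pow_prod'\<close> terms.\<close>
  let ?F = "\<lambda>t. t ^ k * pow_prod' A m x t - of_nat k * t ^ (k - 1) * pow_prod A m x t"
  let ?g = "\<lambda>t. t ^ (k - 2) * pow_prod A m x t"
  have hol: "pow_prod'' A m x holomorphic_on UNIV"
    unfolding pow_prod''_def[abs_def] by (intro holomorphic_intros)
  have "(?F has_field_derivative
      t ^ k * pow_prod'' A m x t - of_nat k * of_nat (k - 1) * ?g t) (at t)" for t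
    by (auto intro!: derivative_eq_intros DERIV_pow_prod DERIV_pow_prod'
        simp: algebra_simps numeral_2_eq_2)
  from contour_integral_linepath_primitive[OF this]
  have prim: "?I (\<lambda>t. t ^ k * pow_prod'' A m x t - of_nat k * of_nat (k - 1) * ?g t)
      = x b ^ k * pow_prod' A m x (x b) - x a ^ k * pow_prod' A m x (x a)"
    using assms by (simp add: pow_prod_root)
  have lin: "?I (\<lambda>t. t ^ k * pow_prod'' A m x t - of_nat k * of_nat (k - 1) * ?g t)
      = ?I (\<lambda>t. t ^ k * pow_prod'' A m x t) - ?I (\<lambda>t. of_nat k * of_nat (k - 1) * ?g t)"
    by (intro contour_integral_diff contour_integrable_linepath_entire holomorphic_intros hol)
  have scale: "?I (\<lambda>t. of_nat k * of_nat (k - 1) * ?g t) = of_nat k * of_nat (k - 1) * ?I ?g"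
    by (intro contour_integral_lmul contour_integrable_linepath_entire holomorphic_intros)
  show ?thesis
    using lin[unfolded prim scale, symmetric] by (simp only: diff_eq_eq)
qed

text \<open>The diagonal and off-diagonal parts of the operator add up to the integral of
  \<open>t ^ k * pow_prod'' {1..n} m x t\<close>, up to endpoint terms \<open>?B j\<close> and
  \<open>?B 1\<close>, and integration by parts yields the same terms with opposite sign.\<close>

lemma Lop_Qint_pos:
  assumes j: "j \<in> {1..n}" and m: "m > 0" and inj: "inj_on x {1..n}"
  shows "Lop n m (Qint n j k m) x = of_nat k * of_nat (k - 1) * Qint n j (k - 2) m x"
proof -
  let ?I = "contour_integral (linepath (x 1) (x j))"
  let ?A = "{1..n}"
  let ?B = "\<lambda>i. x i ^ k * pow_prod' ?A m x (x i)"
  let ?u = "\<lambda>i t. (t - x i) ^ (m - 2) * (t ^ k * pow_prod (?A - {i}) m x t)"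
  let ?v = "\<lambda>i l t. t ^ k * ((t - x i) ^ (m - 1) * (t - x l) ^ (m - 1) * pow_prod (?A - {i} - {l}) m x t)"
  let ?M = "of_nat m :: complex"
  let ?M1 = "of_nat (m - 1) :: complex"
  have one: "1 \<in> ?A" using j by auto
  have "(\<Sum>i\<in>?A. partial_deriv i (partial_deriv i (Qint n j k m)) x)
      = (\<Sum>i\<in>?A. ?M * ?M1 * ?I (?u i) - of_bool (i = j) * ?B i + of_bool (i = 1) * ?B i)"
    by (intro sum.cong refl partial_deriv2_Qint m)
  also have "\<dots> = ?M * ?M1 * (\<Sum>i\<in>?A. ?I (?u i)) - (\<Sum>i\<in>?A. of_bool (i = j) * ?B i)
      + (\<Sum>i\<in>?A. of_bool (i = 1) * ?B i)"
    by (simp only: sum.distrib sum_subtractf sum_distrib_left)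
  also have "(\<Sum>i\<in>?A. of_bool (i = j) * ?B i) = ?B j"
    using j by (simp add: of_bool_def if_distrib[of "\<lambda>c. c * _"] cong: if_cong)
  also have "(\<Sum>i\<in>?A. of_bool (i = 1) * ?B i) = ?B 1"
    using one by (simp add: of_bool_def if_distrib[of "\<lambda>c. c * _"] cong: if_cong)
  finally have lap: "(\<Sum>i\<in>?A. partial_deriv i (partial_deriv i (Qint n j k m)) x)
      = ?M * ?M1 * (\<Sum>i\<in>?A. ?I (?u i)) - ?B j + ?B 1" .
  have "(\<Sum>i\<in>?A. \<Sum>l\<in>{i<..n}.
        1 / (x i - x l) * (partial_deriv i (Qint n j k m) x - partial_deriv l (Qint n j k m) x))
      = (\<Sum>i\<in>?A. \<Sum>l\<in>{i<..n}. - ?M * ?I (?v i l))"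
    \<comment> \<open>Injectivity of \<open>x\<close> makes every denominator with
      \<open>i < l\<close> nonzero.\<close>
    by (intro sum.cong refl partial_deriv_Qint_diff m) (auto dest: inj_onD[OF inj])
  also have "\<dots> = - ?M * (\<Sum>i\<in>?A. \<Sum>l\<in>{i<..n}. ?I (?v i l))"
    by (simp only: sum_distrib_left)
  finally have fst_order: "2 * ?M * (\<Sum>i\<in>?A. \<Sum>l\<in>{i<..n}.
        1 / (x i - x l) * (partial_deriv i (Qint n j k m) x - partial_deriv l (Qint n j k m) x))
      = - (?M ^ 2 * (2 * (\<Sum>i\<in>?A. \<Sum>l\<in>{i<..n}. ?I (?v i l))))"
    by (simp add: power2_eq_square)
  have sym: "?I (?v i l) = ?I (?v l i)" for i l
  proof -
    have "?A - {i} - {l} = ?A - {l} - {i}" by auto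
    then show ?thesis by (simp only: mult.commute)
  qed
  have offdiag: "2 * (\<Sum>i\<in>?A. \<Sum>l\<in>{i<..n}. ?I (?v i l)) = (\<Sum>i\<in>?A. \<Sum>l\<in>?A - {i}. ?I (?v i l))"
    by (rule sum_offdiag_symmetric[of "\<lambda>i l. ?I (?v i l)", symmetric]) (rule sym)
  have "t ^ k * pow_prod'' ?A m x t
      = ?M * ?M1 * (\<Sum>i\<in>?A. ?u i t) + ?M ^ 2 * (\<Sum>i\<in>?A. \<Sum>l\<in>?A - {i}. ?v i l t)" for t
    by (simp only: pow_prod''_def distrib_left sum_distrib_left mult_ac)
  then have "?I (\<lambda>t. t ^ k * pow_prod'' ?A m x t)
      = ?I (\<lambda>t. ?M * ?M1 * (\<Sum>i\<in>?A. ?u i t) + ?M ^ 2 * (\<Sum>i\<in>?A. \<Sum>l\<in>?A - {i}. ?v i l t))"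
    by (simp only:)
  also have "\<dots> = ?I (\<lambda>t. ?M * ?M1 * (\<Sum>i\<in>?A. ?u i t))
      + ?I (\<lambda>t. ?M ^ 2 * (\<Sum>i\<in>?A. \<Sum>l\<in>?A - {i}. ?v i l t))"
    by (intro contour_integral_add contour_integrable_linepath_entire holomorphic_intros)
  also have "?I (\<lambda>t. ?M * ?M1 * (\<Sum>i\<in>?A. ?u i t)) = ?M * ?M1 * ?I (\<lambda>t. \<Sum>i\<in>?A. ?u i t)"
    by (intro contour_integral_lmul contour_integrable_linepath_entire holomorphic_intros)
  also have "?I (\<lambda>t. \<Sum>i\<in>?A. ?u i t) = (\<Sum>i\<in>?A. ?I (?u i))"
    by (intro contour_integral_sum contour_integrable_linepath_entire holomorphic_intros
        finite_atLeastAtMost)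
  also have "?I (\<lambda>t. ?M ^ 2 * (\<Sum>i\<in>?A. \<Sum>l\<in>?A - {i}. ?v i l t))
      = ?M ^ 2 * ?I (\<lambda>t. \<Sum>i\<in>?A. \<Sum>l\<in>?A - {i}. ?v i l t)"
    by (intro contour_integral_lmul contour_integrable_linepath_entire holomorphic_intros)
  also have "?I (\<lambda>t. \<Sum>i\<in>?A. \<Sum>l\<in>?A - {i}. ?v i l t) = (\<Sum>i\<in>?A. ?I (\<lambda>t. \<Sum>l\<in>?A - {i}. ?v i l t))"
    by (intro contour_integral_sum contour_integrable_linepath_entire holomorphic_intros
        finite_atLeastAtMost)
  also have "\<dots> = (\<Sum>i\<in>?A. \<Sum>l\<in>?A - {i}. ?I (?v i l))"
    by (intro sum.cong refl contour_integral_sum contour_integrable_linepath_entire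
        holomorphic_intros finite_Diff finite_atLeastAtMost)
  finally have total: "?I (\<lambda>t. t ^ k * pow_prod'' ?A m x t)
      = ?M * ?M1 * (\<Sum>i\<in>?A. ?I (?u i)) + ?M ^ 2 * (\<Sum>i\<in>?A. \<Sum>l\<in>?A - {i}. ?I (?v i l))" .
  \<comment> \<open>The first identity merges the two parts of the operator into
    \<open>total\<close>; the second cancels the boundary terms after integration by parts.\<close>
  have alg: "a - b + c - (- d) = a + d - b + c" "b - c + d - b + c = d" for a b c d :: complex
    by simp_all
  have "Lop n m (Qint n j k m) x = ?I (\<lambda>t. t ^ k * pow_prod'' ?A m x t) - ?B j + ?B 1"
    unfolding Lop_def lap fst_order offdiag total by (rule alg)
  then show ?thesis
    unfolding contour_integral_pow_prod''[OF finite_atLeastAtMost one j m] Qint_pow_prod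
    by (simp only: alg)
qed

section \<open>The case \<open>m = 0\<close>\<close>

lemma Qint_0: "Qint n j k 0 x = (x j ^ Suc k - x 1 ^ Suc k) / of_nat (Suc k)"
proof -
  have "((\<lambda>t. t ^ Suc k / of_nat (Suc k)) has_field_derivative t ^ k) (at t)" for t :: complex
    by (auto intro!: derivative_eq_intros simp del: of_nat_Suc power_Suc)
  from contour_integral_linepath_primitive[OF this] show ?thesis
    unfolding Qint_def by (simp add: diff_divide_distrib)
qed

lemma DERIV_coordinate_power:
  "((\<lambda>z. (x(i := z)) c ^ k) has_field_derivative of_bool (i = c) * (of_nat k * x c ^ (k - 1)))
    (at (x i :: complex))"
  by (cases "i = c") (auto intro!: derivative_eq_intros)

text \<open>For \<open>m = 0\<close> endpoint terms already survive the first differentiation, since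
  \<open>0 ^ 0 = 1\<close>, so this case is computed from the closed form \<open>Qint_0\<close>. The
  first-order part of the operator has coefficient zero.\<close>

lemma Lop_Qint_0:
  assumes j: "j \<in> {1..n}"
  shows "Lop n 0 (Qint n j k 0) x = of_nat k * of_nat (k - 1) * Qint n j (k - 2) 0 x"
proof -
  have one: "1 \<in> {1..n}" using j by auto
  have first: "partial_deriv i (Qint n j k 0) x = of_bool (i = j) * x j ^ k - of_bool (i = 1) * x 1 ^ k"
    for i x
    unfolding partial_deriv_def Qint_0
    by (rule DERIV_imp_deriv,
        rule DERIV_cong[OF DERIV_cdivide[OF DERIV_diff[OF DERIV_coordinate_power DERIV_coordinate_power]]])
      (simp add: field_simps del: of_nat_Suc)
  have second: "partial_deriv i (partial_deriv i (Qint n j k 0)) x =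
      of_bool (i = j) * (of_nat k * x j ^ (k - 1)) - of_bool (i = 1) * (of_nat k * x 1 ^ (k - 1))" for i
    unfolding partial_deriv_def[of i "partial_deriv i (Qint n j k 0)"] first
    by (rule DERIV_imp_deriv,
        rule DERIV_cong[OF DERIV_diff[OF DERIV_cmult[OF DERIV_coordinate_power] DERIV_cmult[OF DERIV_coordinate_power]]])
      (simp add: of_bool_def)
  have "Lop n 0 (Qint n j k 0) x = of_nat k * (x j ^ (k - 1) - x 1 ^ (k - 1))"
    unfolding Lop_def second using j one
    by (simp add: sum_subtractf of_bool_def if_distrib[of "\<lambda>c. c * _"] right_diff_distrib cong: if_cong)
  also have "\<dots> = of_nat k * of_nat (k - 1) * Qint n j (k - 2) 0 x"
  \<comment> \<open>For \<open>k < 2\<close> the truncated \<open>k - 2\<close> is not the intended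
    exponent, but \<open>k * (k - 1)\<close> is zero; the left side vanishes too, by its factor
    \<open>k\<close> or because both powers are 1.\<close>
  proof (cases "k \<ge> 2")
    case True
    then have "Suc (k - 2) = k - 1" by simp
    then show ?thesis unfolding Qint_0 using True by simp
  next
    case False
    then have "k = 0 \<or> k = 1" by linarith
    then show ?thesis by auto
  qed
  finally show ?thesis .
qed

theorem theorem7p1:
  fixes n m j :: nat
  assumes "n \<ge> 2" and "j \<in> {2..n}"
  shows "(\<forall>k\<ge>2. \<forall>x. inj_on x {1..n} \<longrightarrow>
            Lop n m (Qint n j k m) x = of_nat k * (of_nat k - 1) * Qint n j (k - 2) m x)
       \<and> (\<forall>k\<in>{0,1}. \<forall>x. inj_on x {1..n} \<longrightarrow> Lop n m (Qint n j k m) x = 0)"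
proof -
  have j: "j \<in> {1..n}" using assms by auto
  \<comment> \<open>With truncated subtraction one formula serves both claims: the coefficient is
    zero for \<open>k = 0\<close> and \<open>k = 1\<close>, and for \<open>k \<ge> 2\<close> the
    subtraction commutes with \<open>of_nat\<close>.\<close>
  have "Lop n m (Qint n j k m) x = of_nat k * of_nat (k - 1) * Qint n j (k - 2) m x"
    if "inj_on x {1..n}" for k x
    using Lop_Qint_pos[OF j _ that] Lop_Qint_0[OF j] by (cases "m = 0") auto
  then show ?thesis by (auto simp: of_nat_diff)
qed

end
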